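(* Suppose $q$ is a positive rational number and $k$ is a positive integer satisfying $k \geq q$. Suppose $G$ is a graph such that $\epsilon_{\ell}(G,k) \geq 1/q$. If $G' = K_1 \vee G$, then $1/(q+1) \leq \epsilon_{\ell}(G',k+1)$.
   Context: All graphs are nonempty, finite, and simple. $G \vee H$ denotes the join of vertex-disjoint graphs $G$ and $H$ (every vertex of $G$ is made adjacent to every vertex of $H$), and $K_1\vee G$ is the cone of $G$. A list assignment $L$ for $G$ assigns to each vertex $v$ a set $L(v)$ of colors; it is a $k$-assignment if $|L(v)|=k$ for every $v \in V(G)$. A proper $L$-coloring of $G$ is a proper coloring $f$ with $f(v)\in L(v)$ for all $v \in V(G)$. $G$ is $k$-choosable if it has a proper $L$-coloring for every $k$-assignment $L$, and the list chromatic number $\chi_\ell(G)$ is the smallest $m$ such that $G$ is $m$-choosable. A request of $L$ is a function $r$ with nonempty domain $D \subseteq V(G)$ such that $r(v)\in L(v)$ for each $v\in D$. For $\epsilon\in[0,1]$, the triple $(G,L,r)$ is $\epsilon$-satisfiable if there is a proper $L$-coloring $f$ of $G$ with $f(v)=r(v)$ for at least $\epsilon|D|$ vertices $v\in D$. The pair $(G,L)$ is $\epsilon$-flexible if $(G,L,r)$ is $\epsilon$-satisfiable for every request $r$ of $L$. $G$ is $(k,\epsilon)$-flexible if $(G,L)$ is $\epsilon$-flexible for every $k$-assignment $L$ for $G$. The list epsilon flexibility function $\epsilon_\ell(G,k)$ maps each $k\geq \chi_\ell(G)$ to the largest $\epsilon\in[0,1]$ such that $G$ is $(k,\epsilon)$-flexible.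 (It is only defined for $k \geq \chi_\ell(G)$, so the hypothesis $\epsilon_\ell(G,k)\ge 1/q$ presupposes $k\geq \chi_\ell(G)$.) *)

theory Defs
  imports Complex_Main "Graph_Theory.Graph_Theory"
begin

text \<open>
  A simple graph is a symmetric loop-free digraph without parallel arcs (\<^locale>\<open>pair_graph\<close>):
  an edge \<open>uv\<close> is the pair of arcs \<open>(u, v)\<close>, \<open>(v, u)\<close>. The locale includes finiteness but admits
  the null graph.
\<close>

text \<open>Only meaningful for graphs with disjoint vertex sets.\<close>

definition graph_join ::
  "'a pair_pre_digraph \<Rightarrow> 'a pair_pre_digraph \<Rightarrow> 'a pair_pre_digraph" where
  "graph_join G H =
     \<lparr> pverts = pverts G \<union> pverts H,
       parcs = parcs G \<union> parcs H \<union> pverts G \<times> pverts H \<union> pverts H \<times> pverts G \<rparr>"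

text \<open>
  Colors are natural numbers; this is no restriction, since the lists of a \<open>k\<close>-assignment of a
  finite graph contain only finitely many colors in total. Finiteness of the lists is required
  explicitly because \<^const>\<open>card\<close> is \<open>0\<close> on infinite sets. The values of list assignments and
  colorings outside the vertex set are irrelevant.
\<close>

type_synonym 'a list_assignment = "'a \<Rightarrow> nat set"

definition k_assignment :: "'a pair_pre_digraph \<Rightarrow> nat \<Rightarrow> 'a list_assignment \<Rightarrow> bool" where
  "k_assignment G k L \<longleftrightarrow> (\<forall>v\<in>pverts G. finite (L v) \<and> card (L v) = k)"

definition proper_list_coloring ::
  "'a pair_pre_digraph \<Rightarrow> 'a list_assignment \<Rightarrow> ('a \<Rightarrow> nat) \<Rightarrow> bool" where
  "proper_list_coloring G L f \<longleftrightarrow>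
     (\<forall>v\<in>pverts G. f v \<in> L v) \<and> (\<forall>(u, v)\<in>parcs G. f u \<noteq> f v)"

definition choosable :: "'a pair_pre_digraph \<Rightarrow> nat \<Rightarrow> bool" where
  "choosable G k \<longleftrightarrow> (\<forall>L. k_assignment G k L \<longrightarrow> (\<exists>f. proper_list_coloring G L f))"

definition list_chromatic_number :: "'a pair_pre_digraph \<Rightarrow> nat" where
  "list_chromatic_number G = (LEAST m. choosable G m)"

text \<open>A request is a partial function; its domain is the set \<open>D\<close> of vertices making a request.\<close>

definition is_request ::
  "'a pair_pre_digraph \<Rightarrow> 'a list_assignment \<Rightarrow> ('a \<rightharpoonup> nat) \<Rightarrow> bool" where
  "is_request G L r \<longleftrightarrow>
     dom r \<noteq> {} \<and> dom r \<subseteq> pverts G \<and> (\<forall>v\<in>dom r. the (r v) \<in> L v)"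

definition satisfiable ::
  "real \<Rightarrow> 'a pair_pre_digraph \<Rightarrow> 'a list_assignment \<Rightarrow> ('a \<rightharpoonup> nat) \<Rightarrow> bool" where
  "satisfiable \<epsilon> G L r \<longleftrightarrow>
     (\<exists>f. proper_list_coloring G L f \<and>
          real (card {v \<in> dom r. f v = the (r v)}) \<ge> \<epsilon> * real (card (dom r)))"

definition list_flexible :: "real \<Rightarrow> 'a pair_pre_digraph \<Rightarrow> 'a list_assignment \<Rightarrow> bool" where
  "list_flexible \<epsilon> G L \<longleftrightarrow> (\<forall>r. is_request G L r \<longrightarrow> satisfiable \<epsilon> G L r)"

definition flexible :: "'a pair_pre_digraph \<Rightarrow> nat \<Rightarrow> real \<Rightarrow> bool" where
  "flexible G k \<epsilon> \<longleftrightarrow> (\<forall>L. k_assignment G k L \<longrightarrow> list_flexible \<epsilon> G L)"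

text \<open>Only meaningful for \<open>k \<ge> list_chromatic_number G\<close>; otherwise unspecified.\<close>

definition list_flexibility :: "'a pair_pre_digraph \<Rightarrow> nat \<Rightarrow> real" where
  "list_flexibility G k = (GREATEST \<epsilon>. 0 \<le> \<epsilon> \<and> \<epsilon> \<le> 1 \<and> flexible G k \<epsilon>)"

end

theory Submission
  imports Defs
begin

text \<open>
  The heart of the matter is one averaging argument. Let \<open>w\<close> be the apex of the cone and let \<open>L\<close> be
  a \<open>(k + 1)\<close>-assignment with a request of domain \<open>D\<close>. Once \<open>w\<close> gets a color \<open>c \<in> L w\<close>, each vertex
  \<open>v\<close> of \<open>G\<close> still has at least \<open>k\<close> colors other than \<open>c\<close>, and \<open>k\<close> of them may be chosen to
  include the color requested at \<open>v\<close>, unless that color is \<open>c\<close>. Flexibility of \<open>G\<close> therefore satisfies at least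
  \<open>1/q\<close> of the requests on \<open>G\<close> that do not ask for \<open>c\<close> (\<open>cone_coloring\<close>).

  Choose \<open>c\<close> at random: the color requested at \<open>w\<close> (any color, if \<open>w\<close> makes no request) gets
  probability \<open>1/(q + 1)\<close> and the other \<open>k\<close> colors share \<open>q/(q + 1)\<close> equally. As \<open>q \<le> k\<close>, no color has
  probability above \<open>1/(q + 1)\<close>, so each request on \<open>G\<close> avoids \<open>c\<close> with probability at least
  \<open>q/(q + 1)\<close>. In expectation the requests on \<open>G\<close> thus contribute at least \<open>1/(q + 1)\<close> each, and so
  does the request at \<open>w\<close>. Hence some \<open>c\<close> satisfies at least \<open>|D|/(q + 1)\<close> requests
  (\<open>exists_apex_color\<close>, \<open>flexible_cone\<close>).

  The rest concerns the extremal definitions of the two parameters. The list chromatic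
  number is attained because a graph on \<open>n\<close> vertices is \<open>n\<close>-choosable, and choosability is
  monotone. The flexibility function is attained because, for each list assignment and request, the
  number of satisfied requests takes finitely many values, so the supremum of the admissible
  \<open>\<epsilon>\<close> is itself admissible.
\<close>

section \<open>Choosability and the list chromatic number\<close>

lemma exists_system_of_distinct_representatives:
  assumes "finite A" and "\<And>v. v \<in> A \<Longrightarrow> finite (L v) \<and> card A \<le> card (L v)"
  shows "\<exists>f. inj_on f A \<and> (\<forall>v\<in>A. f v \<in> L v)"
  using assms
proof (induction A rule: finite_induct)
  case empty
  then show ?case by simp
next
  case (insert x A)
  then obtain f where f: "inj_on f A" "\<forall>v\<in>A. f v \<in> L v"
    by fastforce
  have "card (f ` A) < card (L x)"
    using insert.hyps insert.prems[of x] card_image_le[of A f] by simp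
  then obtain c where c: "c \<in> L x" "c \<notin> f ` A"
    using insert.hyps(1) card_mono[of "f ` A" "L x"] by (metis finite_imageI not_less subsetI)
  have "inj_on (f(x := c)) (insert x A)"
    using f(1) c(2) insert.hyps(2) by (auto simp: inj_on_def)
  moreover have "\<forall>v\<in>insert x A. (f(x := c)) v \<in> L v"
    using f(2) c(1) by simp
  ultimately show ?case by blast
qed

lemma choosable_card_pverts:
  assumes "pair_graph G"
  shows "choosable G (card (pverts G))"
  unfolding choosable_def
proof (intro allI impI)
  interpret pair_graph G by fact
  fix L :: "'a list_assignment"
  assume "k_assignment G (card (pverts G)) L"
  then obtain f where f: "inj_on f (pverts G)" "\<forall>v\<in>pverts G. f v \<in> L v"
    using exists_system_of_distinct_representatives[of "pverts G" L] pair_finite_verts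
    by (auto simp: k_assignment_def)
  have "f u \<noteq> f v" if "(u, v) \<in> parcs G" for u v
    using that f(1) in_arcsD1[OF that] in_arcsD2[OF that] pair_no_loops[OF that]
    by (auto dest: inj_onD)
  then show "\<exists>f. proper_list_coloring G L f"
    using f(2) unfolding proper_list_coloring_def by blast
qed

lemma choosable_mono:
  assumes "choosable G m" and "m \<le> k"
  shows "choosable G k"
  unfolding choosable_def
proof (intro allI impI)
  fix L :: "'a list_assignment"
  assume L: "k_assignment G k L"
  have "\<exists>M. M \<subseteq> L v \<and> finite M \<and> card M = m" if "v \<in> pverts G" for v
    using that L assms(2) obtain_subset_with_card_n[of m "L v"]
    unfolding k_assignment_def by metis
  then obtain M where M: "\<And>v. v \<in> pverts G \<Longrightarrow> M v \<subseteq> L v \<and> finite (M v) \<and> card (M v) = m"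
    by metis
  then obtain f where "proper_list_coloring G M f"
    using assms(1) unfolding choosable_def k_assignment_def by blast
  then have "proper_list_coloring G L f"
    using M unfolding proper_list_coloring_def by blast
  then show "\<exists>f. proper_list_coloring G L f"
    by blast
qed

lemma choosable_if_list_chromatic_number_le:
  assumes "pair_graph G" and "list_chromatic_number G \<le> k"
  shows "choosable G k"
proof -
  have "choosable G (list_chromatic_number G)"
    unfolding list_chromatic_number_def by (rule LeastI, rule choosable_card_pverts[OF assms(1)])
  then show ?thesis using assms(2) by (rule choosable_mono)
qed

text \<open>
  A nonempty list always offers some color to request, and satisfying a request, even to the degree
  \<open>0\<close>, takes a proper coloring.
\<close>

lemma choosable_if_flexible:
  assumes "flexible G k \<epsilon>" and "pverts G \<noteq> {}" and "k > 0"
  shows "choosable G k"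
  unfolding choosable_def
proof (intro allI impI)
  fix L :: "'a list_assignment"
  assume L: "k_assignment G k L"
  obtain v where v: "v \<in> pverts G"
    using assms(2) by blast
  then obtain c where "c \<in> L v"
    using L assms(3) unfolding k_assignment_def by fastforce
  then have "is_request G L [v \<mapsto> c]"
    using v by (simp add: is_request_def)
  then show "\<exists>f. proper_list_coloring G L f"
    using assms(1) L unfolding flexible_def list_flexible_def satisfiable_def by blast
qed

section \<open>The flexibility function is attained\<close>

text \<open>
  For a fixed list assignment and request, the largest proportion of requests that a proper coloring
  satisfies is attained, because only finitely many counts occur. It bounds every admissible \<open>\<epsilon>\<close>
  from above, hence also their supremum, which is therefore admissible itself. Choosability makes
  \<open>0\<close> admissible, so the supremum exists.
\<close>

lemma list_flexibility_greatest:
  assumes fin: "finite (pverts G)" and ch: "choosable G k"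
  shows "flexible G k (list_flexibility G k)"
    and "\<lbrakk>0 \<le> \<epsilon>; \<epsilon> \<le> 1; flexible G k \<epsilon>\<rbrakk> \<Longrightarrow> \<epsilon> \<le> list_flexibility G k"
proof -
  define S where "S = {\<epsilon>::real. 0 \<le> \<epsilon> \<and> \<epsilon> \<le> 1 \<and> flexible G k \<epsilon>}"
  have zero: "0 \<in> S"
    using ch unfolding S_def flexible_def list_flexible_def satisfiable_def choosable_def by auto
  have bdd: "bdd_above S"
    unfolding S_def by (rule bdd_aboveI[of _ 1]) simp
  have upper: "\<epsilon> \<le> Sup S" if "\<epsilon> \<in> S" for \<epsilon>
    using that bdd by (rule cSup_upper)
  have "satisfiable (Sup S) G L r" if L: "k_assignment G k L" and r: "is_request G L r" for L r
  proof -
    let ?count = "\<lambda>f. card {v \<in> dom r. f v = the (r v)}"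
    let ?C = "?count ` {f. proper_list_coloring G L f}"
    have fin_dom: "finite (dom r)" and dom: "card (dom r) > 0"
      using r fin finite_subset by (auto simp: is_request_def card_gt_0_iff)
    have "?C \<subseteq> {..card (dom r)}"
      using fin_dom by (auto intro: card_mono)
    then have fin_C: "finite ?C"
      using finite_subset by blast
    have "?C \<noteq> {}"
      using ch L by (auto simp: choosable_def)
    then have "Max ?C \<in> ?C"
      using fin_C by (rule Max_in[rotated])
    then obtain g where g: "proper_list_coloring G L g" "?count g = Max ?C"
      by auto
    have "\<epsilon> \<le> real (?count g) / real (card (dom r))" if "\<epsilon> \<in> S" for \<epsilon>
    proof -
      have "satisfiable \<epsilon> G L r"
        using that L r unfolding S_def flexible_def list_flexible_def by blast
      then obtain f where f: "proper_list_coloring G L f" "\<epsilon> * real (card (dom r)) \<le> real (?count f)"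
        unfolding satisfiable_def by blast
      have "?count f \<le> ?count g"
        unfolding g(2) using fin_C f(1) by (intro Max_ge) auto
      then show ?thesis
        using f(2) dom by (simp add: pos_le_divide_eq)
    qed
    then have "Sup S \<le> real (?count g) / real (card (dom r))"
      using zero by (intro cSup_least) auto
    then show ?thesis
      using g(1) dom unfolding satisfiable_def by (auto simp: pos_le_divide_eq)
  qed
  then have "flexible G k (Sup S)"
    unfolding flexible_def list_flexible_def by blast
  moreover have "0 \<le> Sup S"
    using zero by (rule upper)
  moreover have "Sup S \<le> 1"
    by (rule cSup_least) (use zero in blast, simp add: S_def)
  ultimately have Sup: "0 \<le> Sup S \<and> Sup S \<le> 1 \<and> flexible G k (Sup S)"
    by blast
  have "list_flexibility G k = Sup S"
    unfolding list_flexibility_def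
    using Sup upper by (intro Greatest_equality) (auto simp: S_def)
  then show "flexible G k (list_flexibility G k)"
    and "\<lbrakk>0 \<le> \<epsilon>; \<epsilon> \<le> 1; flexible G k \<epsilon>\<rbrakk> \<Longrightarrow> \<epsilon> \<le> list_flexibility G k"
    using Sup upper by (auto simp: S_def)
qed

lemma flexible_antimono:
  assumes "flexible G k \<delta>" and "\<epsilon> \<le> \<delta>"
  shows "flexible G k \<epsilon>"
proof -
  have "\<epsilon> * real n \<le> \<delta> * real n" for n
    using assms(2) by (simp add: mult_right_mono)
  then show ?thesis
    using assms(1) unfolding flexible_def list_flexible_def satisfiable_def
    by (meson order_trans)
qed

section \<open>Flexibility of a cone\<close>

text \<open>
  With \<open>c\<close> spent on the apex, a \<open>k\<close>-assignment for \<open>G\<close> is carved out of the lists with \<open>c\<close> removed. A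
  list that did not contain \<open>c\<close> is one color too long, and \<open>k > 0\<close> leaves room to keep the
  requested color while shortening it. If every request on \<open>G\<close> asks for \<open>c\<close>, nothing is left to
  satisfy and choosability of \<open>G\<close> provides the coloring.
\<close>

lemma cone_coloring:
  assumes fin: "pair_fin_digraph G" and ch: "choosable G k" and flex: "flexible G k \<epsilon>"
    and "k > 0"
    and K: "pverts K = {w}" "parcs K = {}" and w: "w \<notin> pverts G"
    and L: "k_assignment (graph_join K G) (Suc k) L"
    and r: "dom r \<subseteq> insert w (pverts G)" "\<forall>v\<in>dom r. the (r v) \<in> L v"
    and c: "c \<in> L w"
  shows "\<exists>f. proper_list_coloring (graph_join K G) L f \<and> f w = c \<and>
           \<epsilon> * real (card {v \<in> dom r - {w}. the (r v) \<noteq> c})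
             \<le> real (card {v \<in> dom r - {w}. f v = the (r v)})"
proof -
  interpret pair_fin_digraph G by fact
  define R where "R = r |` {v \<in> dom r - {w}. the (r v) \<noteq> c}"
  have dom_R: "dom R = {v \<in> dom r - {w}. the (r v) \<noteq> c}"
    unfolding R_def by auto
  have R_in: "set_option (R v) \<subseteq> L v - {c}" for v
    using r(2) by (force simp: R_def restrict_map_def split: if_splits)
  have "\<forall>v\<in>pverts G. \<exists>M. set_option (R v) \<subseteq> M \<and> M \<subseteq> L v - {c} \<and> finite M \<and> card M = k"
  proof
    fix v
    assume "v \<in> pverts G"
    have Lv: "finite (L v)" "card (L v) = Suc k"
      using L \<open>v \<in> pverts G\<close> by (auto simp: k_assignment_def graph_join_def)
    then have "k \<le> card (L v - {c})"
      by (simp add: card_Diff_singleton_if)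
    moreover have "card (set_option (R v)) \<le> k"
      using \<open>k > 0\<close> by (cases "R v") auto
    ultimately obtain M where "set_option (R v) \<subseteq> M" "M \<subseteq> L v - {c}" "card M = k"
      using exists_subset_between[OF _ _ R_in[of v]] Lv(1) by blast
    then show "\<exists>M. set_option (R v) \<subseteq> M \<and> M \<subseteq> L v - {c} \<and> finite M \<and> card M = k"
      using Lv(1) by (intro exI[of _ M]) (auto intro: finite_subset)
  qed
  from bchoice[OF this] obtain M where M: "\<And>v. v \<in> pverts G \<Longrightarrow>
      set_option (R v) \<subseteq> M v \<and> M v \<subseteq> L v - {c} \<and> finite (M v) \<and> card (M v) = k"
    by blast
  have kM: "k_assignment G k M"
    using M by (simp add: k_assignment_def)
  obtain f where f: "proper_list_coloring G M f"
    "\<epsilon> * real (card (dom R)) \<le> real (card {v \<in> dom R. f v = the (R v)})"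
  proof (cases "dom R = {}")
    case True
    then show ?thesis
      using ch kM that unfolding choosable_def by fastforce
  next
    case False
    have "dom R \<subseteq> pverts G"
      using r(1) dom_R by auto
    moreover from this have "\<forall>v\<in>dom R. the (R v) \<in> M v"
      using M by (metis domD option.sel option.set_intros subsetD)
    ultimately have "is_request G M R"
      using False by (simp add: is_request_def)
    then show ?thesis
      using flex kM that unfolding flexible_def list_flexible_def satisfiable_def by blast
  qed
  let ?g = "f(w := c)"
  have f_in: "f v \<in> L v \<and> f v \<noteq> c" if "v \<in> pverts G" for v
    using f(1) M[OF that] that unfolding proper_list_coloring_def by blast
  have g: "?g w = c" "\<And>v. v \<in> pverts G \<Longrightarrow> ?g v = f v"
    using w by auto
  have "?g u \<noteq> ?g v" if "(u, v) \<in> parcs (graph_join K G)" for u v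
  proof -
    have "(u, v) \<in> parcs G \<or> u = w \<and> v \<in> pverts G \<or> v = w \<and> u \<in> pverts G"
      using that K by (auto simp: graph_join_def)
    moreover have "?g u \<noteq> ?g v" if "(u, v) \<in> parcs G"
      using that f(1) g(2) in_arcsD1[OF that] in_arcsD2[OF that]
      by (auto simp: proper_list_coloring_def)
    ultimately show ?thesis
      using g f_in by metis
  qed
  moreover have "?g v \<in> L v" if "v \<in> pverts (graph_join K G)" for v
    using that K c f_in by (auto simp: graph_join_def)
  ultimately have "proper_list_coloring (graph_join K G) L ?g"
    unfolding proper_list_coloring_def by blast
  moreover have "card {v \<in> dom R. f v = the (R v)}
      \<le> card {v \<in> dom r - {w}. ?g v = the (r v)}"
    using r(1) pair_finite_verts finite_subset[of "dom r"]
    by (intro card_mono) (auto simp: R_def restrict_map_def split: if_splits)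
  ultimately show ?thesis
    using f(2) unfolding dom_R by (intro exI[of _ ?g]) auto
qed

text \<open>
  An average over \<open>C\<close> with weight \<open>1/(q + 1)\<close> at \<open>a\<close> and \<open>q/((q + 1) k)\<close> at each of the other \<open>k\<close>
  colors. Since \<open>q \<le> k\<close>, the weights are at most \<open>1/(q + 1)\<close>, so every request keeps weight at least
  \<open>q/(q + 1)\<close> when the color it asks for is left out, and the factor \<open>1/q\<close> turns this into \<open>1/(q + 1)\<close>.
  Here \<open>E\<close> stands for the requests on \<open>G\<close>, \<open>\<rho>\<close> for the requested colors, \<open>a\<close> for the preferred
  color of the apex and \<open>b\<close> for the gain from giving the apex that color.
\<close>

lemma exists_apex_color:
  fixes q b :: real and \<rho> :: "'a \<Rightarrow> 'c"
  assumes "q > 0" and "q \<le> real k"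
    and C: "finite C" "card C = Suc k" "a \<in> C" and E: "finite E"
  shows "\<exists>c\<in>C. (b + real (card E)) / (q + 1)
           \<le> (if c = a then b else 0) + 1 / q * real (card {v \<in> E. \<rho> v \<noteq> c})"
proof (rule ccontr)
  assume contra: "\<not> ?thesis"
  define T where "T = (b + real (card E)) / (q + 1)"
  define gain where
    "gain c = (if c = a then b else 0) + 1 / q * real (card {v \<in> E. \<rho> v \<noteq> c})" for c
  define p where "p c = (if c = a then 1 / (q + 1) else q / ((q + 1) * real k))" for c
  have "k > 0" using assms by simp
  have small: "gain c < T" if "c \<in> C" for c
    using that contra unfolding gain_def T_def by force
  have "q / real k \<le> 1"
    using assms(1,2) by simp
  then have "q / real k / (q + 1) \<le> 1 / (q + 1)"
    using assms(1) by (intro divide_right_mono) auto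
  then have p_le: "p c \<le> 1 / (q + 1)" for c
    by (simp add: p_def mult.commute)
  have p_pos: "p c > 0" for c
    using assms(1) \<open>k > 0\<close> by (simp add: p_def add_pos_pos)
  have "(\<Sum>c\<in>C - {a}. p c) = q / (q + 1)"
    using C \<open>k > 0\<close> by (simp add: p_def)
  then have sum_p: "sum p C = 1"
    using C assms(1) by (simp add: sum.remove[of C a] p_def field_simps)
  have avoid: "(\<Sum>c\<in>C. p c * of_bool (\<rho> v \<noteq> c)) \<ge> q / (q + 1)" for v
  proof -
    have "(\<Sum>c\<in>C. p c * of_bool (\<rho> v \<noteq> c)) = (\<Sum>c\<in>C. p c - (if c = \<rho> v then p c else 0))"
      by (intro sum.cong) auto
    also have "\<dots> = 1 - (if \<rho> v \<in> C then p (\<rho> v) else 0)"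
      using C(1) sum_p by (simp add: sum_subtractf sum.delta)
    also have "\<dots> \<ge> 1 - 1 / (q + 1)"
      using p_le[of "\<rho> v"] assms(1) by simp
    also have "1 - 1 / (q + 1) = q / (q + 1)"
      using assms(1) by (simp add: field_simps)
    finally show ?thesis .
  qed
  have "real (card E) * (q / (q + 1)) \<le> (\<Sum>v\<in>E. \<Sum>c\<in>C. p c * of_bool (\<rho> v \<noteq> c))"
    using avoid by (intro sum_bounded_below)
  also have "\<dots> = (\<Sum>c\<in>C. p c * real (card {v \<in> E. \<rho> v \<noteq> c}))"
    using E by (subst sum.swap) (simp add: sum_distrib_left[symmetric] Int_def)
  finally have "1 / q * (real (card E) * (q / (q + 1)))
      \<le> 1 / q * (\<Sum>c\<in>C. p c * real (card {v \<in> E. \<rho> v \<noteq> c}))"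
    using assms(1) by (intro mult_left_mono) auto
  moreover have "b / (q + 1) = (\<Sum>c\<in>C. p c * (if c = a then b else 0))"
    using C by (simp add: sum.delta if_distrib[of "\<lambda>x. _ * x"] p_def cong: if_cong)
  moreover have "T = b / (q + 1) + 1 / q * (real (card E) * (q / (q + 1)))"
    using assms(1) by (simp add: T_def add_divide_distrib)
  ultimately have "T \<le> (\<Sum>c\<in>C. p c * gain c)"
    by (simp add: gain_def sum_distrib_left distrib_left sum.distrib mult.left_commute)
  also have "\<dots> < (\<Sum>c\<in>C. p c * T)"
    using C small p_pos by (intro sum_strict_mono) auto
  also have "\<dots> = T"
    using sum_p by (simp add: sum_distrib_right[symmetric])
  finally show False
    by simp
qed

lemma flexible_cone:
  fixes q :: real
  assumes "pair_graph G" and "choosable G k" and "flexible G k (1 / q)"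
    and q: "q > 0" "q \<le> real k"
    and K: "pverts K = {w}" "parcs K = {}" and w: "w \<notin> pverts G"
  shows "flexible (graph_join K G) (Suc k) (1 / (q + 1))"
  unfolding flexible_def list_flexible_def
proof (intro allI impI)
  interpret pair_graph G by fact
  fix L r
  assume L: "k_assignment (graph_join K G) (Suc k) L" and "is_request (graph_join K G) L r"
  then have dom: "dom r \<subseteq> insert w (pverts G)" and r: "\<forall>v\<in>dom r. the (r v) \<in> L v"
    using K by (auto simp: is_request_def graph_join_def)
  then have fin: "finite (dom r)"
    using pair_finite_verts finite_subset by blast
  have Lw: "finite (L w)" "card (L w) = Suc k"
    using L K by (auto simp: k_assignment_def graph_join_def)
  \<comment> \<open>The preferred apex color; arbitrary if the apex makes no request, for then its gain \<open>b\<close> is \<open>0\<close>.\<close>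
  define a where "a = (if w \<in> dom r then the (r w) else SOME c. c \<in> L w)"
  have "L w \<noteq> {}"
    using Lw by auto
  then have a: "a \<in> L w"
    using r by (auto simp: a_def some_in_eq)
  define b :: nat where "b = of_bool (w \<in> dom r)"
  have card_dom: "card (dom r) = b + card (dom r - {w})"
    using fin card_Suc_Diff1[of "dom r" w] by (cases "w \<in> dom r") (simp_all add: b_def)
  have "finite (dom r - {w})"
    using fin by simp
  then obtain c where c: "c \<in> L w" "(real b + real (card (dom r - {w}))) / (q + 1)
      \<le> (if c = a then real b else 0) + 1 / q * real (card {v \<in> dom r - {w}. the (r v) \<noteq> c})"
    using exists_apex_color[OF q Lw a, of "dom r - {w}" "real b" "\<lambda>v. the (r v)"] by blast
  obtain f where f: "proper_list_coloring (graph_join K G) L f" "f w = c"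
    "1 / q * real (card {v \<in> dom r - {w}. the (r v) \<noteq> c})
       \<le> real (card {v \<in> dom r - {w}. f v = the (r v)})"
    using cone_coloring[OF pair_fin_digraph_axioms assms(2,3) _ K w L dom r c(1)] q by auto
  let ?B = "if c = a \<and> w \<in> dom r then {w} else {}"
  have "(if c = a then b else 0) + card {v \<in> dom r - {w}. f v = the (r v)}
      = card (?B \<union> {v \<in> dom r - {w}. f v = the (r v)})"
    using fin by (subst card_Un_disjoint) (auto simp: b_def)
  also have "\<dots> \<le> card {v \<in> dom r. f v = the (r v)}"
    using fin f(2) by (intro card_mono) (auto simp: a_def split: if_splits)
  finally have "real (if c = a then b else 0) + real (card {v \<in> dom r - {w}. f v = the (r v)})
      \<le> real (card {v \<in> dom r. f v = the (r v)})"
    by linarith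
  then have "1 / (q + 1) * real (card (dom r)) \<le> real (card {v \<in> dom r. f v = the (r v)})"
    using c(2) f(3) card_dom by (auto split: if_splits)
  then show "satisfiable (1 / (q + 1)) (graph_join K G) L r"
    using f(1) unfolding satisfiable_def by blast
qed

theorem theorem6:
  fixes q :: rat and k :: nat and G K G' :: "'a pair_pre_digraph"
  assumes "q > 0" and "k > 0" and "of_nat k \<ge> q"
    and "pair_graph G" and "pverts G \<noteq> {}"
    and "list_chromatic_number G \<le> k"
    and "list_flexibility G k \<ge> 1 / of_rat q"
    and "complete_digraph 1 (with_proj K)" and "pverts K \<inter> pverts G = {}"
    and "G' = graph_join K G"
  shows "list_chromatic_number G' \<le> k + 1 \<and> 1 / (of_rat q + 1) \<le> list_flexibility G' (k + 1)"
proof -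
  interpret G: pair_graph G by fact
  define q' :: real where "q' = of_rat q"
  have q': "q' > 0" "q' \<le> real k"
    using assms(1,3) unfolding q'_def
    by (simp_all add: of_rat_less_eq[symmetric, where 'a = real, of q "of_nat k"])
  obtain w where K: "pverts K = {w}"
    using assms(8) unfolding complete_digraph_pair_def by (meson card_1_singletonE)
  have "parcs K = {}"
    using assms(8) K unfolding complete_digraph_pair_def by auto
  have ch: "choosable G k"
    using assms(4,6) by (rule choosable_if_list_chromatic_number_le)
  have "flexible G k (1 / q')"
    using list_flexibility_greatest(1)[OF G.pair_finite_verts ch] assms(7)
    unfolding q'_def by (rule flexible_antimono)
  then have flex: "flexible G' (k + 1) (1 / (q' + 1))"
    using flexible_cone[OF assms(4) ch _ q' K \<open>parcs K = {}\<close>] assms(9) K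
    unfolding assms(10) by simp
  have V: "finite (pverts G')" "pverts G' \<noteq> {}"
    using K G.pair_finite_verts by (auto simp: assms(10) graph_join_def)
  have ch': "choosable G' (k + 1)"
    using choosable_if_flexible[OF flex V(2)] by simp
  have "1 / (q' + 1) \<le> list_flexibility G' (k + 1)"
    using q'(1) by (intro list_flexibility_greatest(2)[OF V(1) ch' _ _ flex]) auto
  moreover have "list_chromatic_number G' \<le> k + 1"
    unfolding list_chromatic_number_def using ch' by (rule Least_le)
  ultimately show ?thesis
    by (simp add: q'_def)
qed

end
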